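(* Let $p\ge 1$ and for $i=1,2,\dots,p$ let $\tau^{[i]}\in S_{d_{i,0}}(132)$ be a nonempty $132$-avoiding pattern with canonical decomposition $$\tau^{[i]}=(\tau^{i,0},d_{i,0},\tau^{i,1},d_{i,1},\dots,\tau^{i,m_i},d_{i,m_i}),$$ such that for $i\ne i'$ the pattern $\tau^{[i]}$ does not contain $\tau^{[i']}$. Then $$F_{\{\tau^{[1]},\dots,\tau^{[p]}\}}(x)=1+x\sum_{j_1=0}^{m_1}\sum_{j_2=0}^{m_2}\dots\sum_{j_p=0}^{m_p} F_{\{\pi^{j_1}(\tau^{[1]}),\dots,\pi^{j_p}(\tau^{[p]})\}}^{\pi^{j_1-1}(\tau^{[1]}),\dots,\pi^{j_p-1}(\tau^{[p]})}(x)\; F_{\{\sigma^{j_1}(\tau^{[1]}),\dots,\sigma^{j_p}(\tau^{[p]})\}}(x),$$ where $$F_{\{\pi^{j_1}(\tau^{[1]}),\dots,\pi^{j_p}(\tau^{[p]})\}}^{\pi^{j_1-1}(\tau^{[1]}),\dots,\pi^{j_p-1}(\tau^{[p]})}(x)=\sum_{j=0}^p (-1)^j \sum_{1\leq i_1<\dots<i_j\leq p} F_{A_{i_1,\dots,i_j}^{j_1,\dots,j_p}}(x),$$ with $$A_{i_1,\dots,i_j}^{j_1,\dots,j_p}=\left\{\pi^{j_q}(\tau^{[q]}) : q\in\{1,\dots,p\}\setminus\{i_1,\dots,i_j\}\right\}\cup\left\{\pi^{j_q-1}(\tau^{[q]}) : q\in\{i_1,\dots,i_j\}\right\}.$$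
   Context: $S_n$ is the set of permutations of $\{1,\dots,n\}$ written as words ($S_0$ consists of the empty permutation). A permutation $\rho\in S_n$ contains a pattern $\tau\in S_k$ if some subsequence of $\rho$ of length $k$ is order-isomorphic to $\tau$; otherwise $\rho$ avoids $\tau$. Every permutation contains the empty pattern $\emptyset$. $S_k(132)$ is the set of permutations in $S_k$ avoiding $132$. Generating functions: for a set $T$ of patterns, $F_T(x)=\sum_{n\ge0} a_n x^n$, where $a_n$ is the number of $\rho\in S_n$ avoiding $132$ and every pattern in $T$ (so $F_T(x)=0$ if $\emptyset\in T$). For patterns $\gamma^{(1)},\dots,\gamma^{(p)}$, $F_T^{\gamma^{(1)},\dots,\gamma^{(p)}}(x)=\sum_{n\ge 0} b_nx^n$, where $b_n$ is the number of $\rho\in S_n$ avoiding $132$ and every pattern in $T$ and containing each $\gamma^{(i)}$ at least once. Canonical decomposition: for nonempty $\tau\in S_k(132)$, let $k=m_0>m_1>\dots>m_r$ be its right-to-left maxima (entries $\tau_i$ with $\tau_i>\tau_j$ for all $j>i$) written from left to right. Then $\tau=(\tau^0,m_0,\tau^1,m_1,\dots,\tau^r,m_r)$ where each $\tau^i$ is a possibly empty block and all entries of $\tau^i$ are greater than $m_{i+1}$ and all entries of $\tau^{i+1}$. The prefixes are $\pi^{-1}(\tau)=\emptyset$, $\pi^0(\tau)=\tau^0$, and $\pi^i(\tau)=(\tau^0,m_0,\dots,\tau^i,m_i)$ for $1\le i\le r$. The suffixes are $\sigma^i(\tau)=(\tau^i,m_i,\dots,\tau^r,m_r)$ for $0\le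 i\le r$. Each prefix or suffix is identified with the unique permutation order-isomorphic to it. (For $\tau^{[i]}$, the right-to-left maxima are $d_{i,0},\dots,d_{i,m_i}$, so $r=m_i$.) *)

theory Defs
  imports
    "HOL-Library.Sublist"
    "HOL-Library.FuncSet"
    "HOL-Combinatorics.Multiset_Permutations"
    "HOL-Computational_Algebra.Formal_Power_Series"
begin

abbreviation perms :: "nat \<Rightarrow> nat list set" where
  "perms n \<equiv> permutations_of_set {1..n}"

definition order_iso :: "nat list \<Rightarrow> nat list \<Rightarrow> bool" where
  "order_iso xs ys \<longleftrightarrow> length xs = length ys \<and>
     (\<forall>a<length xs. \<forall>b<length xs. xs ! a < xs ! b \<longleftrightarrow> ys ! a < ys ! b)"

definition contains :: "nat list \<Rightarrow> nat list \<Rightarrow> bool" where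
  "contains \<rho> \<tau> \<longleftrightarrow> (\<exists>\<sigma>. subseq \<sigma> \<rho> \<and> order_iso \<sigma> \<tau>)"

abbreviation avoids :: "nat list \<Rightarrow> nat list \<Rightarrow> bool" where
  "avoids \<rho> \<tau> \<equiv> \<not> contains \<rho> \<tau>"

definition perms_132 :: "nat \<Rightarrow> nat list set" where
  "perms_132 n = {\<rho> \<in> perms n. avoids \<rho> [1, 3, 2]}"

text \<open>The permutation order-isomorphic to a word of distinct letters: each letter is
  replaced by its rank.\<close>

definition standardize :: "nat list \<Rightarrow> nat list" where
  "standardize xs = map (\<lambda>x. card {y \<in> set xs. y \<le> x}) xs"

definition gf_avoid :: "nat list set \<Rightarrow> int fps" where
  "gf_avoid T = Abs_fps (\<lambda>n. int (card {\<rho> \<in> perms_132 n. \<forall>\<tau>\<in>T. avoids \<rho> \<tau>}))"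

definition gf_avoid_contain :: "nat list set \<Rightarrow> nat list set \<Rightarrow> int fps" where
  "gf_avoid_contain T G = Abs_fps (\<lambda>n. int (card
     {\<rho> \<in> perms_132 n. (\<forall>\<tau>\<in>T. avoids \<rho> \<tau>) \<and> (\<forall>\<gamma>\<in>G. contains \<rho> \<gamma>)}))"

text \<open>Positions (counted from 0, in increasing order) of the right-to-left maxima
  $m_0 > \dots > m_r$; the last index is $r$.\<close>

definition rl_positions :: "nat list \<Rightarrow> nat list" where
  "rl_positions \<tau> =
     filter (\<lambda>a. \<forall>b. a < b \<and> b < length \<tau> \<longrightarrow> \<tau> ! b < \<tau> ! a) [0..<length \<tau>]"

definition last_index :: "nat list \<Rightarrow> nat" where
  "last_index \<tau> = length (rl_positions \<tau>) - 1"

definition rl_max :: "nat list \<Rightarrow> nat \<Rightarrow> nat" where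
  "rl_max \<tau> i = \<tau> ! (rl_positions \<tau> ! i)"

definition block :: "nat list \<Rightarrow> nat \<Rightarrow> nat list" where
  "block \<tau> i = drop (if i = 0 then 0 else Suc (rl_positions \<tau> ! (i - 1)))
                    (take (rl_positions \<tau> ! i) \<tau>)"

text \<open>The word $(\tau^a, m_a, \dots, \tau^{b-1}, m_{b-1})$.\<close>

definition blocks_between :: "nat list \<Rightarrow> nat \<Rightarrow> nat \<Rightarrow> nat list" where
  "blocks_between \<tau> a b = concat (map (\<lambda>i. block \<tau> i @ [rl_max \<tau> i]) [a..<b])"

text \<open>The index of a prefix is an integer because it starts at $-1$. The prefix of index 0
  is $\tau^0$ alone, without $m_0$.\<close>

definition prefix_pat :: "nat list \<Rightarrow> int \<Rightarrow> nat list" where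
  "prefix_pat \<tau> i = standardize
     (if i < 0 then [] else if i = 0 then block \<tau> 0 else blocks_between \<tau> 0 (Suc (nat i)))"

definition suffix_pat :: "nat list \<Rightarrow> nat \<Rightarrow> nat list" where
  "suffix_pat \<tau> i = standardize (blocks_between \<tau> i (Suc (last_index \<tau>)))"

lemma contains_empty: "contains \<rho> []"
  by (auto simp: contains_def order_iso_def)

lemma gf_avoid_empty_pattern: "[] \<in> T \<Longrightarrow> gf_avoid T = 0"
  using contains_empty by (fastforce simp: gf_avoid_def fps_eq_iff card_eq_0_iff)

lemma order_iso_standardize: "order_iso xs (standardize xs)"
proof -
  have "x < y \<longleftrightarrow> card {z \<in> set xs. z \<le> x} < card {z \<in> set xs. z \<le> y}"
    if "x \<in> set xs" "y \<in> set xs" for x y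
  proof
    assume "x < y"
    hence "{z \<in> set xs. z \<le> x} \<subset> {z \<in> set xs. z \<le> y}"
      using that by force
    thus "card {z \<in> set xs. z \<le> x} < card {z \<in> set xs. z \<le> y}"
      by (intro psubset_card_mono) auto
  next
    assume *: "card {z \<in> set xs. z \<le> x} < card {z \<in> set xs. z \<le> y}"
    show "x < y"
    proof (rule ccontr)
      assume "\<not> x < y"
      hence "card {z \<in> set xs. z \<le> y} \<le> card {z \<in> set xs. z \<le> x}"
        by (intro card_mono) auto
      with * show False by simp
    qed
  qed
  thus ?thesis by (simp add: order_iso_def standardize_def)
qed

lemma standardize_in_perms:
  assumes "distinct xs"
  shows "standardize xs \<in> perms (length xs)"
proof -
  let ?r = "\<lambda>x. card {y \<in> set xs. y \<le> x}"
  have inj: "inj_on ?r (set xs)"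
  proof (rule inj_onI)
    fix x y assume xy: "x \<in> set xs" "y \<in> set xs" "?r x = ?r y"
    then obtain a b where ab: "a < length xs" "b < length xs" "x = xs ! a" "y = xs ! b"
      by (metis in_set_conv_nth)
    have "\<not> x < y" "\<not> y < x"
      using order_iso_standardize[of xs] ab xy
      unfolding order_iso_def standardize_def by auto
    thus "x = y" by simp
  qed
  have "?r ` set xs \<subseteq> {1..length xs}"
  proof (intro image_subsetI)
    fix x assume "x \<in> set xs"
    hence "{y \<in> set xs. y \<le> x} \<noteq> {}" by auto
    hence "0 < ?r x" by (simp add: card_gt_0_iff)
    moreover have "?r x \<le> card (set xs)" by (intro card_mono) auto
    ultimately show "?r x \<in> {1..length xs}"
      using card_length[of xs] by simp
  qed
  moreover have "card (?r ` set xs) = card {1..length xs}"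
    using inj assms by (simp add: card_image distinct_card)
  ultimately have "?r ` set xs = {1..length xs}"
    by (intro card_subset_eq) auto
  thus ?thesis
    using inj assms by (auto simp: permutations_of_set_def standardize_def distinct_map)
qed

lemma standardize_perm:
  assumes "xs \<in> perms n"
  shows "standardize xs = xs"
proof -
  have s: "set xs = {1..n}" using assms by (auto simp: permutations_of_set_def)
  have "card {y \<in> set xs. y \<le> x} = x" if "x \<in> set xs" for x
  proof -
    have "{y \<in> set xs. y \<le> x} = {1..x}" using that s by auto
    thus ?thesis by simp
  qed
  thus ?thesis by (simp add: standardize_def map_idI)
qed

lemma standardize_unique:
  assumes "ys \<in> perms n" "order_iso xs ys"
  shows "standardize xs = ys"
proof -
  have l: "length xs = length ys" and
    o: "\<And>a b. a < length xs \<Longrightarrow> b < length xs \<Longrightarrow> xs ! a < xs ! b \<longleftrightarrow> ys ! a < ys ! b"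
    using assms(2) by (auto simp: order_iso_def)
  have o': "xs ! a \<le> xs ! b \<longleftrightarrow> ys ! a \<le> ys ! b" if "a < length xs" "b < length xs" for a b
    using o[OF that(2,1)] by (auto simp: not_less[symmetric])
  have "card {y \<in> set xs. y \<le> xs ! a} = card {y \<in> set ys. y \<le> ys ! a}"
    if a: "a < length xs" for a
  proof -
    let ?I = "{b. b < length xs \<and> xs ! b \<le> xs ! a}"
    have J: "?I = {b. b < length ys \<and> ys ! b \<le> ys ! a}"
      using o' a l by auto
    have dy: "distinct ys" using assms(1) by (simp add: permutations_of_set_def)
    have dx: "distinct xs"
      unfolding distinct_conv_nth
    proof (intro allI impI)
      fix i j assume ij: "i < length xs" "j < length xs" "i \<noteq> j"
      hence "ys ! i \<noteq> ys ! j" using dy l by (simp add: nth_eq_iff_index_eq)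
      thus "xs ! i \<noteq> xs ! j" using o[of i j] o[of j i] ij by auto
    qed
    have "{y \<in> set xs. y \<le> xs ! a} = (!) xs ` ?I" by (auto simp: in_set_conv_nth)
    moreover have "{y \<in> set ys. y \<le> ys ! a} = (!) ys ` ?I"
      unfolding J by (auto simp: in_set_conv_nth)
    moreover have "inj_on ((!) xs) ?I" "inj_on ((!) ys) ?I"
      using dx dy l by (auto simp: inj_on_def nth_eq_iff_index_eq)
    ultimately show ?thesis by (simp add: card_image)
  qed
  hence "standardize xs = standardize ys"
    using l by (auto simp: standardize_def intro: nth_equalityI)
  thus ?thesis using standardize_perm[OF assms(1)] by simp
qed

lemma sorted_rl_positions: "sorted_wrt (<) (rl_positions \<tau>)"
  by (simp add: rl_positions_def sorted_wrt_filter)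

lemma rl_positions_less: "i < length (rl_positions \<tau>) \<Longrightarrow> rl_positions \<tau> ! i < length \<tau>"
  using nth_mem[of i "rl_positions \<tau>"] by (auto simp: rl_positions_def)

lemma blocks_between_0:
  assumes "i < length (rl_positions \<tau>)"
  shows "blocks_between \<tau> 0 (Suc i) = take (Suc (rl_positions \<tau> ! i)) \<tau>"
  using assms
proof (induction i)
  case 0
  thus ?case using rl_positions_less[of 0 \<tau>]
    by (simp add: blocks_between_def block_def rl_max_def take_Suc_conv_app_nth)
next
  case (Suc i)
  let ?a = "rl_positions \<tau> ! i" and ?b = "rl_positions \<tau> ! Suc i"
  have ab: "?a < ?b" using sorted_rl_positions[of \<tau>] Suc.prems
    by (simp add: sorted_wrt_nth_less)
  have b: "?b < length \<tau>" using rl_positions_less[OF Suc.prems] .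
  have "blocks_between \<tau> 0 (Suc (Suc i)) =
      take (Suc ?a) \<tau> @ drop (Suc ?a) (take ?b \<tau>) @ [\<tau> ! ?b]"
    using Suc by (simp add: blocks_between_def block_def rl_max_def)
  also have "take (Suc ?a) \<tau> = take (Suc ?a) (take ?b \<tau>)"
    using ab by (simp add: min_def)
  also have "\<dots> @ drop (Suc ?a) (take ?b \<tau>) @ [\<tau> ! ?b] = take (Suc ?b) \<tau>"
    using b by (simp add: take_Suc_conv_app_nth del: take_take flip: append_assoc)
  finally show ?case .
qed

lemma last_rl_position:
  assumes "\<tau> \<noteq> []"
  shows "rl_positions \<tau> \<noteq> []" "rl_positions \<tau> ! last_index \<tau> = length \<tau> - 1"
proof -
  obtain k where k: "length \<tau> = Suc k" using assms by (cases \<tau>) auto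
  have e: "rl_positions \<tau> = filter (\<lambda>a. \<forall>b. a < b \<and> b < length \<tau> \<longrightarrow> \<tau> ! b < \<tau> ! a) [0..<k] @ [k]"
    by (simp add: rl_positions_def k)
  show "rl_positions \<tau> \<noteq> []" by (simp add: e)
  show "rl_positions \<tau> ! last_index \<tau> = length \<tau> - 1"
    by (simp add: last_index_def e k nth_append)
qed

lemma canonical_decomposition:
  assumes "\<tau> \<noteq> []"
  shows "blocks_between \<tau> 0 (Suc (last_index \<tau>)) = \<tau>"
proof -
  have "last_index \<tau> < length (rl_positions \<tau>)"
    using last_rl_position(1)[OF assms] by (simp add: last_index_def)
  thus ?thesis
    using blocks_between_0 last_rl_position(2)[OF assms] assms by simp
qed

end

theory Submission
  imports Defs
begin

text \<open>
  A 132-avoiding permutation of length $n \ge 1$ has the form $(L, n, R)$ with $L$ and $R$ avoiding 132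
  and every letter of $L$ above every letter of $R$. It contains $\tau$ iff for some
  $0 \le i \le r + 1$ the word $L$ contains $\pi^{i-1}(\tau)$ and $R$ contains $\sigma^i(\tau)$, where
  $\sigma^{r+1}(\tau) = \emptyset$. As $i$ grows the prefixes become more and the suffixes less demanding, so
  $\tau$ is avoided iff, for the first $j$ such that $L$ avoids $\pi^j(\tau)$, one has $j \le r$ and $R$ avoids
  $\sigma^j(\tau)$. Sorting the pairs $(L, R)$ by the tuple of these indices gives the recurrence. The second
  identity is inclusion--exclusion, because containing $\pi^j(\tau)$ implies containing $\pi^{j-1}(\tau)$.
\<close>

section \<open>Pattern containment up to order isomorphism\<close>

lemma order_iso_refl: "order_iso xs xs"
  by (simp add: order_iso_def)

lemma order_iso_sym: "order_iso xs ys \<Longrightarrow> order_iso ys xs"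
  by (simp add: order_iso_def)

lemma order_iso_trans: "order_iso xs ys \<Longrightarrow> order_iso ys zs \<Longrightarrow> order_iso xs zs"
  by (simp add: order_iso_def)

lemma order_iso_map:
  assumes "strict_mono_on (set xs) f"
  shows "order_iso xs (map f xs)"
  using strict_mono_on_less[OF assms] by (simp add: order_iso_def)

text \<open>Equal letters of \<open>xs\<close> sit at positions where the letters of
  \<open>ys\<close> also agree, so reading \<open>ys\<close> position by position is a well-defined
  map on letters. In this form \<open>nths\<close> can be moved through the isomorphism.\<close>

lemma order_isoE:
  assumes "order_iso xs ys"
  obtains f where "ys = map f xs" "strict_mono_on (set xs) f"
proof -
  define f where "f x = ys ! (SOME a. a < length xs \<and> xs ! a = x)" for x
  have f: "f (xs ! a) = ys ! a" if "a < length xs" for a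
  proof -
    define b where "b = (SOME b. b < length xs \<and> xs ! b = xs ! a)"
    have "b < length xs \<and> xs ! b = xs ! a"
      unfolding b_def by (rule someI[of _ a]) (use that in simp)
    hence "\<not> ys ! b < ys ! a" "\<not> ys ! a < ys ! b"
      using assms that unfolding order_iso_def by (metis less_irrefl)+
    moreover have "f (xs ! a) = ys ! b"
      by (simp add: f_def b_def)
    ultimately show ?thesis by simp
  qed
  show ?thesis
  proof
    show "ys = map f xs"
      using assms f by (auto simp: order_iso_def intro: nth_equalityI)
    show "strict_mono_on (set xs) f"
      using assms f by (auto simp: strict_mono_on_def in_set_conv_nth order_iso_def)
  qed
qed

lemma order_iso_take: "order_iso xs ys \<Longrightarrow> order_iso (take s xs) (take s ys)"
  by (simp add: order_iso_def)

lemma order_iso_drop: "order_iso xs ys \<Longrightarrow> order_iso (drop s xs) (drop s ys)"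
  by (simp add: order_iso_def)

lemma order_iso_append:
  assumes "order_iso as bs" "order_iso cs ds"
    and ac: "\<And>x y. x \<in> set as \<Longrightarrow> y \<in> set cs \<Longrightarrow> y < x"
    and bd: "\<And>x y. x \<in> set bs \<Longrightarrow> y \<in> set ds \<Longrightarrow> y < x"
  shows "order_iso (as @ cs) (bs @ ds)"
proof -
  have l: "length as = length bs" "length cs = length ds"
    using assms by (auto simp: order_iso_def)
  have ac': "cs ! j < as ! i" "\<not> as ! i < cs ! j" if "i < length as" "j < length cs" for i j
    using ac[of "as ! i" "cs ! j"] that by auto
  have bd': "ds ! j < bs ! i" "\<not> bs ! i < ds ! j" if "i < length as" "j < length cs" for i j
    using bd[of "bs ! i" "ds ! j"] that l by auto
  show ?thesis
    using assms(1,2) l ac' bd' by (auto simp: order_iso_def nth_append)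
qed

lemma order_iso_snoc_max:
  assumes "order_iso as bs" "\<And>x. x \<in> set as \<Longrightarrow> x < m" "\<And>x. x \<in> set bs \<Longrightarrow> x < n"
  shows "order_iso (as @ [m]) (bs @ [n])"
proof -
  have l: "length as = length bs"
    using assms by (auto simp: order_iso_def)
  have "as ! i < m" "\<not> m < as ! i" "bs ! i < n" "\<not> n < bs ! i" if "i < length as" for i
    using assms(2)[of "as ! i"] assms(3)[of "bs ! i"] that l by auto
  thus ?thesis
    using assms(1) l by (auto simp: order_iso_def nth_append less_Suc_eq)
qed

section \<open>Containment as a preorder compatible with order isomorphism\<close>

lemma subseq_set_subset: "subseq xs ys \<Longrightarrow> set xs \<subseteq> set ys"
  by (auto simp: subseq_conv_nths dest: in_set_nthsD)

lemma contains_subseq: "subseq ys xs \<Longrightarrow> contains xs ys"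
  using order_iso_refl by (auto simp: contains_def)

lemma contains_order_iso: "order_iso xs ys \<Longrightarrow> contains xs ys"
  by (auto simp: contains_def)

lemma contains_trans:
  assumes "contains xs ys" "contains ys zs"
  shows "contains xs zs"
proof -
  obtain us where us: "subseq us xs" "order_iso us ys"
    using assms(1) by (auto simp: contains_def)
  obtain vs where vs: "subseq vs ys" "order_iso vs zs"
    using assms(2) by (auto simp: contains_def)
  obtain f where f: "ys = map f us" "strict_mono_on (set us) f"
    using us(2) by (rule order_isoE)
  \<comment> \<open>The index set of the inner occurrence \<open>vs\<close> is reused on
    \<open>us\<close>, which selects an occurrence of \<open>zs\<close> inside the word that
    contains \<open>us\<close>.\<close>
  obtain N where N: "vs = nths (map f us) N"
    using vs(1) f(1) by (auto simp: subseq_conv_nths)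
  have "order_iso (nths us N) vs"
    unfolding N nths_map
    by (intro order_iso_map strict_mono_onI strict_mono_onD[OF f(2)])
      (auto dest: in_set_nthsD)
  moreover have "subseq (nths us N) us"
    by (auto simp: subseq_conv_nths)
  ultimately show ?thesis
    using us(1) vs(2) by (meson contains_def order_iso_trans subseq_order.order_trans)
qed

lemma contains_cong_left: "order_iso xs ys \<Longrightarrow> contains xs zs \<longleftrightarrow> contains ys zs"
  by (meson contains_order_iso contains_trans order_iso_sym)

text \<open>Allows prefixes and suffixes to be treated as literal segments of \<open>\<tau>\<close>,
  so that ranks never have to be computed.\<close>

lemma contains_standardize: "contains xs (standardize ys) \<longleftrightarrow> contains xs ys"
  by (meson contains_order_iso contains_trans order_iso_standardize order_iso_sym)

section \<open>The pattern 132 in terms of letters\<close>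

lemma order_iso_132_iff: "order_iso [x, y, z] [1, 3, 2] \<longleftrightarrow> x < z \<and> z < y"
  by (auto simp: order_iso_def All_less_Suc)

lemma contains_132_iff: "contains \<rho> [1, 3, 2] \<longleftrightarrow> (\<exists>x y z. subseq [x, y, z] \<rho> \<and> x < z \<and> z < y)"
proof
  assume "contains \<rho> [1, 3, 2]"
  then obtain \<sigma> where \<sigma>: "subseq \<sigma> \<rho>" "order_iso \<sigma> [1, 3, 2]"
    by (auto simp: contains_def)
  hence "length \<sigma> = Suc (Suc (Suc 0))"
    by (simp add: order_iso_def)
  then obtain x y z where "\<sigma> = [x, y, z]"
    by (auto simp: length_Suc_conv)
  with \<sigma> show "\<exists>x y z. subseq [x, y, z] \<rho> \<and> x < z \<and> z < y"
    using order_iso_132_iff by blast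
next
  assume "\<exists>x y z. subseq [x, y, z] \<rho> \<and> x < z \<and> z < y"
  thus "contains \<rho> [1, 3, 2]"
    unfolding contains_def using order_iso_132_iff by blast
qed

section \<open>The cuts of a 132-avoiding pattern\<close>

lemma rl_positions_iff:
  "a \<in> set (rl_positions \<tau>) \<longleftrightarrow> a < length \<tau> \<and> (\<forall>b. a < b \<and> b < length \<tau> \<longrightarrow> \<tau> ! b < \<tau> ! a)"
  by (auto simp: rl_positions_def)

lemma rl_positions_strict_mono:
  "i < j \<Longrightarrow> j < length (rl_positions \<tau>) \<Longrightarrow> rl_positions \<tau> ! i < rl_positions \<tau> ! j"
  using sorted_rl_positions by (simp add: sorted_wrt_nth_less)

lemma rl_positions_nonempty: "\<tau> \<noteq> [] \<Longrightarrow> length (rl_positions \<tau>) = Suc (last_index \<tau>)"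
  using last_rl_position(1)[of \<tau>] by (cases "rl_positions \<tau>") (auto simp: last_index_def)

text \<open>The position of the maximum is a right-to-left maximum, and no earlier position can be
  one because the maximum lies to its right. Hence it comes first in
  \<open>rl_positions\<close>.\<close>

lemma rl_max_0_greatest:
  assumes "\<tau> \<noteq> []" "distinct \<tau>" "a < length \<tau>" "a \<noteq> rl_positions \<tau> ! 0"
  shows "\<tau> ! a < \<tau> ! (rl_positions \<tau> ! 0)"
proof -
  let ?r = "rl_positions \<tau>"
  have r0: "?r ! 0 < length \<tau>" "0 < length ?r"
    using rl_positions_less[of 0 \<tau>] rl_positions_nonempty[OF assms(1)] by auto
  obtain m where m: "m < length \<tau>" "\<tau> ! m = Max (set \<tau>)"
    using Max_in[of "set \<tau>"] assms(1) by (auto simp: in_set_conv_nth)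
  have le: "\<tau> ! b \<le> \<tau> ! m" if "b < length \<tau>" for b
    using m that by simp
  hence lt: "\<tau> ! b < \<tau> ! m" if "b < length \<tau>" "b \<noteq> m" for b
    using m that assms(2) by (metis le_neq_implies_less nth_eq_iff_index_eq)
  have "m \<in> set ?r"
    using m lt by (auto simp: rl_positions_iff)
  then obtain k where k: "k < length ?r" "m = ?r ! k"
    by (auto simp: in_set_conv_nth)
  have "k = 0"
  proof (rule ccontr)
    assume "k \<noteq> 0"
    hence "?r ! 0 < m"
      using rl_positions_strict_mono k by auto
    moreover have "?r ! 0 \<in> set ?r"
      using r0 by auto
    ultimately show False
      using lt[of "?r ! 0"] m r0 by (fastforce simp: rl_positions_iff)
  qed
  thus ?thesis using lt k assms by auto
qed

section \<open>Prefixes and suffixes as segments of the pattern\<close>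

text \<open>The number of letters in front of the block \<tau>^i. At
  \<open>Suc (last_index \<tau>)\<close> it is the whole length of a nonempty
  \<open>\<tau>\<close>.\<close>

definition cut_position :: "nat list \<Rightarrow> nat \<Rightarrow> nat" where
  "cut_position \<tau> i = (if i = 0 then 0 else Suc (rl_positions \<tau> ! (i - 1)))"

text \<open>The length of $\pi^{i-1}(\tau)$; it differs from the cut only at $i = 1$, as $\pi^0$ omits $m_0$.\<close>

definition prefix_length :: "nat list \<Rightarrow> nat \<Rightarrow> nat" where
  "prefix_length \<tau> i = (if i = 1 then rl_positions \<tau> ! 0 else cut_position \<tau> i)"

text \<open>The shift by one lets a natural number run through all prefix indices, starting with
  -1.\<close>

lemma prefix_pat_eq:
  assumes "\<tau> \<noteq> []" "i \<le> Suc (last_index \<tau>)"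
  shows "prefix_pat \<tau> (int i - 1) = standardize (take (prefix_length \<tau> i) \<tau>)"
proof -
  have "int i - 1 < 0 \<longleftrightarrow> i = 0" "int i - 1 = 0 \<longleftrightarrow> i = 1" by auto
  moreover have "blocks_between \<tau> 0 (Suc (nat (int i - 1))) = take (cut_position \<tau> i) \<tau>" if "i \<ge> 2"
  proof -
    have "nat (int i - 1) = i - 1" by auto
    thus ?thesis
      using that assms blocks_between_0[of "i - 1" \<tau>] rl_positions_nonempty[of \<tau>]
      by (simp add: cut_position_def)
  qed
  ultimately show ?thesis
    by (auto simp: prefix_pat_def prefix_length_def block_def cut_position_def)
qed

text \<open>The first \<open>i\<close> blocks form a known initial segment; cancelling it from the
  canonical decomposition leaves the suffix.\<close>

lemma suffix_pat_eq:
  assumes "\<tau> \<noteq> []" "i \<le> Suc (last_index \<tau>)"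
  shows "suffix_pat \<tau> i = standardize (drop (cut_position \<tau> i) \<tau>)"
proof -
  have 1: "blocks_between \<tau> 0 i = take (cut_position \<tau> i) \<tau>"
    using blocks_between_0[of "i - 1" \<tau>] assms rl_positions_nonempty[of \<tau>]
    by (cases i) (auto simp: cut_position_def blocks_between_def)
  have "[0..<Suc (last_index \<tau>)] = [0..<i] @ [i..<Suc (last_index \<tau>)]"
    using assms(2) by (metis le_add_diff_inverse upt_add_eq_append zero_le)
  hence "blocks_between \<tau> 0 i @ blocks_between \<tau> i (Suc (last_index \<tau>)) = \<tau>"
    using canonical_decomposition[OF assms(1)] by (simp add: blocks_between_def del: upt_Suc)
  hence "blocks_between \<tau> i (Suc (last_index \<tau>)) = drop (cut_position \<tau> i) \<tau>"
    unfolding 1 by (metis append_take_drop_id same_append_eq)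
  thus ?thesis by (simp add: suffix_pat_def)
qed

lemma cut_position_mono:
  assumes "\<tau> \<noteq> []" "i \<le> j" "j \<le> Suc (last_index \<tau>)"
  shows "cut_position \<tau> i \<le> cut_position \<tau> j"
proof -
  have "rl_positions \<tau> ! (i - 1) \<le> rl_positions \<tau> ! (j - 1)" if "0 < i"
    using sorted_wrt_nth_less[OF sorted_rl_positions, of "i - 1" "j - 1" \<tau>] that
      rl_positions_nonempty[OF assms(1)] assms(2,3)
    by (cases "i = j") (auto simp: less_imp_le)
  thus ?thesis using assms(2) by (auto simp: cut_position_def)
qed

text \<open>Only the value at 1 deviates from \<open>cut_position\<close>; it is one less than the
  cut there, which keeps it between its neighbours.\<close>

lemma prefix_length_mono:
  assumes "\<tau> \<noteq> []" "i \<le> j" "j \<le> Suc (last_index \<tau>)"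
  shows "prefix_length \<tau> i \<le> prefix_length \<tau> j"
  using cut_position_mono[OF assms] cut_position_mono[OF assms(1), of 1 j] assms(2,3)
  by (auto simp: prefix_length_def cut_position_def split: if_splits)

lemma contains_prefix_pat_mono:
  assumes "\<tau> \<noteq> []" "i \<le> j" "j \<le> Suc (last_index \<tau>)"
    "contains L (prefix_pat \<tau> (int j - 1))"
  shows "contains L (prefix_pat \<tau> (int i - 1))"
proof -
  have "take (prefix_length \<tau> i) \<tau> = take (prefix_length \<tau> i) (take (prefix_length \<tau> j) \<tau>)"
    using prefix_length_mono[OF assms(1-3)] by (simp add: min_def)
  hence "contains (take (prefix_length \<tau> j) \<tau>) (take (prefix_length \<tau> i) \<tau>)"
    by (metis contains_subseq append_take_drop_id subseq_rev_drop_many subseq_order.order_refl)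
  thus ?thesis
    using assms contains_trans by (auto simp: prefix_pat_eq contains_standardize)
qed

lemma contains_suffix_pat_mono:
  assumes "\<tau> \<noteq> []" "i \<le> j" "j \<le> Suc (last_index \<tau>)" "contains R (suffix_pat \<tau> i)"
  shows "contains R (suffix_pat \<tau> j)"
proof -
  have "drop (cut_position \<tau> j) \<tau> = drop (cut_position \<tau> j - cut_position \<tau> i) (drop (cut_position \<tau> i) \<tau>)"
    using cut_position_mono[OF assms(1-3)] by simp
  hence "contains (drop (cut_position \<tau> i) \<tau>) (drop (cut_position \<tau> j) \<tau>)"
    by (metis contains_subseq append_take_drop_id subseq_drop_many subseq_order.order_refl)
  thus ?thesis
    using assms contains_trans by (auto simp: suffix_pat_eq contains_standardize)
qed

text \<open>This extra index accounts for occurrences that use no letter of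
  \<open>R\<close>.\<close>

lemma suffix_pat_last: "suffix_pat \<tau> (Suc (last_index \<tau>)) = []"
  by (simp add: suffix_pat_def blocks_between_def standardize_def)

lemma prefix_pat_minus_1: "prefix_pat \<tau> (- 1) = []"
  by (simp add: prefix_pat_def standardize_def)


text \<open>The letter just before the cut is a right-to-left maximum and exceeds \<open>y\<close>.
  If \<open>x < y\<close>, then \<open>x\<close>, this maximum and \<open>y\<close> would form a
  132.\<close>

lemma cut_descent:
  assumes "distinct \<tau>" "avoids \<tau> [1, 3, 2]" "\<tau> \<noteq> []" "i \<le> Suc (last_index \<tau>)"
    and x: "x \<in> set (take (cut_position \<tau> i) \<tau>)" and y: "y \<in> set (drop (cut_position \<tau> i) \<tau>)"
  shows "y < x"
proof -
  define c where "c = rl_positions \<tau> ! (i - 1)"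
  have i: "0 < i" using x by (cases i) (auto simp: cut_position_def)
  hence c: "c \<in> set (rl_positions \<tau>)"
    using assms(3,4) by (auto simp: c_def rl_positions_nonempty)
  have cl: "c < length \<tau>" using c by (simp add: rl_positions_iff)
  have cut: "cut_position \<tau> i = Suc c" using i by (simp add: cut_position_def c_def)
  obtain b where "b < length \<tau> - Suc c" "y = \<tau> ! (Suc c + b)"
    using y by (auto simp: cut in_set_conv_nth)
  hence yc: "y < \<tau> ! c"
    using c by (simp add: rl_positions_iff)
  have split: "\<tau> = take c \<tau> @ \<tau> ! c # drop (Suc c) \<tau>"
    using cl by (rule id_take_nth_drop)
  show ?thesis
  proof (cases "x = \<tau> ! c")
    case True
    thus ?thesis using yc by simp
  next
    case False
    hence xc: "x \<in> set (take c \<tau>)"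
      using x cl by (simp add: cut take_Suc_conv_app_nth)
    have "subseq ([x] @ [\<tau> ! c, y]) (take c \<tau> @ \<tau> ! c # drop (Suc c) \<tau>)"
      using xc y by (intro list_emb_append_mono) (auto simp: subseq_singleton_left cut)
    hence "subseq [x, \<tau> ! c, y] \<tau>"
      using split by simp
    hence "\<not> x < y"
      using assms(2) yc contains_132_iff by blast
    moreover have "x \<noteq> y"
      using assms(1) x y by (metis append_take_drop_id disjoint_iff distinct_append)
    ultimately show ?thesis by simp
  qed
qed

section \<open>Occurrences of a pattern in a word split at its largest letter\<close>

text \<open>An occurrence of $\tau$ in $(L, n, R)$ uses letters of $(L, n)$ for an initial segment of $\tau$
  exceeding the rest of $\tau$, so the segment is empty or ends in a right-to-left maximum. The letter
  $n$ can only play the role of $m_0$, and then $L$ contains $\pi^0(\tau)$.\<close>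

lemma contains_glued_iff:
  assumes \<tau>: "distinct \<tau>" "avoids \<tau> [1, 3, 2]" "\<tau> \<noteq> []"
    and LR: "\<And>x y. x \<in> set L \<Longrightarrow> y \<in> set R \<Longrightarrow> y < x"
    and n: "\<And>x. x \<in> set L \<union> set R \<Longrightarrow> x < n"
  shows "contains (L @ n # R) \<tau> \<longleftrightarrow>
    (\<exists>i\<le>Suc (last_index \<tau>). contains L (prefix_pat \<tau> (int i - 1)) \<and> contains R (suffix_pat \<tau> i))"
    (is "_ \<longleftrightarrow> (\<exists>i\<le>?m. ?P i)")
proof -
  let ?r = "rl_positions \<tau>"
  have P: "?P i \<longleftrightarrow> contains L (take (prefix_length \<tau> i) \<tau>) \<and> contains R (drop (cut_position \<tau> i) \<tau>)"
    if "i \<le> ?m" for i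
    using that \<tau>(3) by (simp add: prefix_pat_eq suffix_pat_eq contains_standardize)
  show ?thesis
  proof
    assume "contains (L @ n # R) \<tau>"
    then obtain \<sigma> where \<sigma>: "subseq \<sigma> ((L @ [n]) @ R)" "order_iso \<sigma> \<tau>"
      by (auto simp: contains_def)
    obtain \<sigma>1 \<sigma>2 where s: "\<sigma> = \<sigma>1 @ \<sigma>2" "subseq \<sigma>1 (L @ [n])" "subseq \<sigma>2 R"
      using \<sigma>(1) by (rule subseq_appendE)
    have len: "length \<sigma> = length \<tau>"
      and lt: "\<And>a b. a < length \<tau> \<Longrightarrow> b < length \<tau> \<Longrightarrow> \<sigma> ! a < \<sigma> ! b \<longleftrightarrow> \<tau> ! a < \<tau> ! b"
      using \<sigma>(2) by (auto simp: order_iso_def)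
    have R: "contains R (drop (length \<sigma>1) \<tau>)"
      using order_iso_drop[OF \<sigma>(2), of "length \<sigma>1"] s by (auto simp: contains_def)
    show "\<exists>i\<le>?m. ?P i"
    proof (cases "length \<sigma>1")
      case 0
      hence "?P 0"
        using R by (subst P) (auto simp: cut_position_def prefix_length_def contains_empty)
      thus ?thesis by blast
    next
      case (Suc t)
      have t: "t < length \<tau>" using Suc len s by simp
      have "\<sigma> ! t = \<sigma>1 ! t" using Suc s by (simp add: nth_append)
      moreover have "\<sigma>1 ! t \<in> set \<sigma>1" using Suc by simp
      ultimately have st: "\<sigma> ! t \<in> set L \<union> {n}"
        using s(2) subseq_set_subset by fastforce
      \<comment> \<open>Position \<open>t\<close> is the last one realized in \<open>(L, n)\<close>;
        everything after it is realized in \<open>R\<close>, hence lower. So \<open>t\<close> is a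
        right-to-left maximum and the split is a cut.\<close>
      have "\<tau> ! b < \<tau> ! t" if b: "t < b" "b < length \<tau>" for b
      proof -
        have "\<sigma> ! b \<in> set \<sigma>2"
          using b Suc len s(1) by (auto simp: nth_append)
        hence "\<sigma> ! b \<in> set R"
          using s(3) subseq_set_subset by blast
        hence "\<sigma> ! b < \<sigma> ! t"
          using st LR n by auto
        thus ?thesis using lt b t by blast
      qed
      hence "t \<in> set ?r"
        using t by (simp add: rl_positions_iff)
      then obtain k where k: "k < length ?r" "?r ! k = t"
        by (auto simp: in_set_conv_nth)
      have km: "Suc k \<le> ?m"
        using k \<tau>(3) by (simp add: rl_positions_nonempty)
      have cut: "cut_position \<tau> (Suc k) = Suc t" using k by (simp add: cut_position_def)
      obtain \<sigma>3 \<sigma>4 where s3: "\<sigma>1 = \<sigma>3 @ \<sigma>4" "subseq \<sigma>3 L" "subseq \<sigma>4 [n]"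
        using s(2) by (rule subseq_appendE)
      have "\<sigma>4 = [] \<or> \<sigma>4 = [n]"
        using s3(3) by (cases \<sigma>4) (auto split: if_splits)
      hence "contains L (take (prefix_length \<tau> (Suc k)) \<tau>)"
      proof
        assume "\<sigma>4 = []"
        hence "contains L (take (Suc t) \<tau>)"
          using order_iso_take[OF \<sigma>(2), of "Suc t"] s s3 Suc by (auto simp: contains_def)
        \<comment> \<open>Without \<open>n\<close>, the word \<open>L\<close> contains the segment
          up to the cut. For \<open>k = 0\<close> this is one letter more than required, since
          \<pi>^0 omits m_0.\<close>
        moreover have "take (prefix_length \<tau> (Suc k)) \<tau> = take (prefix_length \<tau> (Suc k)) (take (Suc t) \<tau>)"
          using k cut by (cases "k = 0") (simp_all add: prefix_length_def min_def)
        hence "contains (take (Suc t) \<tau>) (take (prefix_length \<tau> (Suc k)) \<tau>)"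
          by (metis contains_subseq append_take_drop_id subseq_rev_drop_many subseq_order.order_refl)
        ultimately show ?thesis by (rule contains_trans)
      next
        assume s4: "\<sigma>4 = [n]"
        hence t': "length \<sigma>3 = t" using s3 Suc by simp
        \<comment> \<open>If a later right-to-left maximum were played by \<open>n\<close>, then m_0
          would have to be played by a letter of \<open>L\<close> larger than
          \<open>n\<close>.\<close>
        have "k = 0"
        proof (rule ccontr)
          assume "k \<noteq> 0"
          hence r0: "?r ! 0 < t" "?r ! 0 \<in> set ?r"
            using rl_positions_strict_mono[of 0 k \<tau>] k by (auto intro!: nth_mem)
          hence "\<sigma> ! t < \<sigma> ! (?r ! 0)"
            using t lt by (auto simp: rl_positions_iff)
          moreover have "\<sigma> ! t = n"
            using s s3 s4 t' by (simp add: nth_append)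
          moreover have "\<sigma> ! (?r ! 0) \<in> set \<sigma>3"
            using s s3 s4 t' r0 by (simp add: nth_append)
          hence "\<sigma> ! (?r ! 0) \<in> set L"
            using s3(2) subseq_set_subset by blast
          ultimately show False using n by fastforce
        qed
        moreover have "order_iso \<sigma>3 (take t \<tau>)"
          using order_iso_take[OF \<sigma>(2), of t] s s3 t' by simp
        ultimately show ?thesis
          using s3(2) k by (auto simp: contains_def prefix_length_def)
      qed
      hence "?P (Suc k)" using R km cut Suc by (subst P) auto
      thus ?thesis using km by blast
    qed
  next
    assume "\<exists>i\<le>?m. ?P i"
    then obtain i where i: "i \<le> ?m" "?P i" by blast
    obtain \<sigma>1 where s1: "subseq \<sigma>1 L" "order_iso \<sigma>1 (take (prefix_length \<tau> i) \<tau>)"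
      using i P[OF i(1)] by (auto simp: contains_def)
    obtain \<sigma>2 where s2: "subseq \<sigma>2 R" "order_iso \<sigma>2 (drop (cut_position \<tau> i) \<tau>)"
      using i P[OF i(1)] by (auto simp: contains_def)
    have set12: "set \<sigma>1 \<subseteq> set L" "set \<sigma>2 \<subseteq> set R"
      using s1(1) s2(1) by (auto dest: subseq_set_subset)
    \<comment> \<open>For \<open>i = 1\<close> the prefix lacks m_0, and appending \<open>n\<close>
      supplies it. For all other indices the occurrence in \<open>L\<close> already reaches the
      cut.\<close>
    have "\<exists>\<sigma>3. subseq \<sigma>3 (L @ [n]) \<and> order_iso \<sigma>3 (take (cut_position \<tau> i) \<tau>) \<and> set \<sigma>3 \<subseteq> set L \<union> {n}"
    proof (cases "i = 1")
      case False
      thus ?thesis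
        using s1 set12 by (auto simp: prefix_length_def)
    next
      case True
      let ?t = "?r ! 0"
      have t: "?t < length \<tau>" using rl_positions_less[of 0 \<tau>] \<tau>(3) by (simp add: rl_positions_nonempty)
      have "order_iso (\<sigma>1 @ [n]) (take ?t \<tau> @ [\<tau> ! ?t])"
      proof (rule order_iso_snoc_max)
        show "order_iso \<sigma>1 (take ?t \<tau>)" using s1 True by (simp add: prefix_length_def)
        show "x < n" if "x \<in> set \<sigma>1" for x using that set12 n by auto
        show "x < \<tau> ! ?t" if "x \<in> set (take ?t \<tau>)" for x
          using that rl_max_0_greatest[OF \<tau>(3,1)] by (auto simp: in_set_conv_nth)
      qed
      moreover have "take (cut_position \<tau> i) \<tau> = take ?t \<tau> @ [\<tau> ! ?t]"
        using True t by (simp add: cut_position_def take_Suc_conv_app_nth)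
      ultimately show ?thesis
        using s1 set12 by (intro exI[of _ "\<sigma>1 @ [n]"]) auto
    qed
    then obtain \<sigma>3 where s3: "subseq \<sigma>3 (L @ [n])" "order_iso \<sigma>3 (take (cut_position \<tau> i) \<tau>)"
      "set \<sigma>3 \<subseteq> set L \<union> {n}" by blast
    have "order_iso (\<sigma>3 @ \<sigma>2) (take (cut_position \<tau> i) \<tau> @ drop (cut_position \<tau> i) \<tau>)"
    proof (rule order_iso_append[OF s3(2) s2(2)])
      show "y < x" if "x \<in> set \<sigma>3" "y \<in> set \<sigma>2" for x y
      proof -
        have "y \<in> set R" "x \<in> set L \<or> x = n" using that s3(3) set12 by auto
        thus ?thesis using LR n by blast
      qed
    qed (use cut_descent[OF \<tau> i(1)] in blast)
    moreover have "subseq (\<sigma>3 @ \<sigma>2) ((L @ [n]) @ R)"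
      using s3(1) s2(1) by (rule list_emb_append_mono)
    ultimately show "contains (L @ n # R) \<tau>"
      by (auto simp: contains_def)
  qed
qed

lemma prefix_pat_Suc: "prefix_pat \<tau> (int (Suc j) - 1) = prefix_pat \<tau> (int j)"
  by simp

lemma avoids_glued_iff:
  assumes \<tau>: "distinct \<tau>" "avoids \<tau> [1, 3, 2]" "\<tau> \<noteq> []"
    and LR: "\<And>x y. x \<in> set L \<Longrightarrow> y \<in> set R \<Longrightarrow> y < x"
    and n: "\<And>x. x \<in> set L \<union> set R \<Longrightarrow> x < n"
  shows "avoids (L @ n # R) \<tau> \<longleftrightarrow>
    (\<exists>j\<le>last_index \<tau>. contains L (prefix_pat \<tau> (int j - 1)) \<and> avoids L (prefix_pat \<tau> (int j)) \<and>
       avoids R (suffix_pat \<tau> j))"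
proof
  let ?P = "\<lambda>i. contains L (prefix_pat \<tau> (int i - 1))" and ?S = "\<lambda>i. contains R (suffix_pat \<tau> i)"
  assume "avoids (L @ n # R) \<tau>"
  hence PS: "\<not> (?P i \<and> ?S i)" if "i \<le> Suc (last_index \<tau>)" for i
    using contains_glued_iff[OF assms] that by blast
  hence "\<not> ?P (Suc (last_index \<tau>))"
    using suffix_pat_last contains_empty by (metis order_refl)
  moreover have "?P 0" by (simp add: prefix_pat_minus_1 contains_empty)
  \<comment> \<open>The first prefix missing from \<open>L\<close> has index \<open>j\<close>. One
    is missing because the suffix paired with the last prefix is empty, and the prefix of index -1
    is always present.\<close>
  ultimately obtain j where j: "j < Suc (last_index \<tau>)" "\<forall>i\<le>j. ?P i" "\<not> ?P (Suc j)"
    using ex_least_nat_less[of "\<lambda>i. \<not> ?P i" "Suc (last_index \<tau>)"] by blast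
  hence "?P j" "\<not> ?S j" using PS[of j] by auto
  thus "\<exists>j\<le>last_index \<tau>. ?P j \<and> avoids L (prefix_pat \<tau> (int j)) \<and> \<not> ?S j"
    using j prefix_pat_Suc[of \<tau> j] by (intro exI[of _ j]) auto
next
  assume "\<exists>j\<le>last_index \<tau>. contains L (prefix_pat \<tau> (int j - 1)) \<and> avoids L (prefix_pat \<tau> (int j)) \<and>
       avoids R (suffix_pat \<tau> j)"
  then obtain j where j: "j \<le> last_index \<tau>" "avoids L (prefix_pat \<tau> (int (Suc j) - 1))"
    "avoids R (suffix_pat \<tau> j)"
    unfolding prefix_pat_Suc by blast
  show "avoids (L @ n # R) \<tau>"
  proof
    assume "contains (L @ n # R) \<tau>"
    then obtain i where i: "i \<le> Suc (last_index \<tau>)" "contains L (prefix_pat \<tau> (int i - 1))"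
      "contains R (suffix_pat \<tau> i)"
      using contains_glued_iff[OF assms] by blast
    \<comment> \<open>An occurrence cut at or before \<open>j\<close> would put the suffix of index
      \<open>j\<close> into \<open>R\<close>; one cut later would put the prefix of index
      \<open>j\<close> into \<open>L\<close>.\<close>
    show False
    proof (cases "i \<le> j")
      case True
      thus ?thesis using contains_suffix_pat_mono[OF \<tau>(3) True _ i(3)] j by simp
    next
      case False
      thus ?thesis using contains_prefix_pat_mono[OF \<tau>(3) _ i(1,2), of "Suc j"] j by simp
    qed
  qed
qed

text \<open>Of two different indices, the larger forces \<open>L\<close> to contain the very prefix
  that the smaller forbids. This makes the classes of the recurrence disjoint.\<close>

lemma prefix_index_unique:
  assumes "\<tau> \<noteq> []" "i \<le> last_index \<tau>" "j \<le> last_index \<tau>"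
    "contains L (prefix_pat \<tau> (int i - 1))" "avoids L (prefix_pat \<tau> (int i))"
    "contains L (prefix_pat \<tau> (int j - 1))" "avoids L (prefix_pat \<tau> (int j))"
  shows "i = j"
  using contains_prefix_pat_mono[OF assms(1), of "Suc i" j L]
    contains_prefix_pat_mono[OF assms(1), of "Suc j" i L] assms(2-)
  unfolding prefix_pat_Suc by (cases i j rule: linorder_cases) auto

section \<open>Splitting a permutation at its largest letter\<close>

text \<open>Taking \<open>L\<close> and \<open>R\<close> as permutations in their own right and
  shifting only here lets them be counted independently, so that the counts multiply.\<close>

definition glue :: "nat list \<Rightarrow> nat list \<Rightarrow> nat list" where
  "glue L R = map (\<lambda>x. x + length R) L @ Suc (length L + length R) # R"

lemma perms_132_iff: "\<rho> \<in> perms_132 n \<longleftrightarrow> distinct \<rho> \<and> set \<rho> = {1..n} \<and> avoids \<rho> [1, 3, 2]"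
  by (auto simp: perms_132_def permutations_of_set_def)

lemma length_perms_132: "\<rho> \<in> perms_132 n \<Longrightarrow> length \<rho> = n"
  by (metis perms_132_iff card_atLeastAtMost diff_Suc_1 distinct_card)

lemma finite_perms_132: "finite (perms_132 n)"
  by (simp add: perms_132_def)

lemma contains_map_add: "contains (map (\<lambda>x. x + c) L) \<tau> \<longleftrightarrow> contains L \<tau>"
proof -
  have "order_iso L (map (\<lambda>x. x + c) L)"
    by (rule order_iso_map) (simp add: strict_mono_on_def)
  thus ?thesis using contains_cong_left by blast
qed

text \<open>The first letter of a 132 is below its last, so the two cannot lie in \<open>L\<close>
  and \<open>R\<close> respectively. Neither of them can be \<open>n\<close>, as the middle letter
  is larger. Hence both lie on one side, and the middle letter with them.\<close>

lemma contains_132_gluedD: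
  assumes "contains (L @ n # R) [1, 3, 2]"
    and LR: "\<And>x y. x \<in> set L \<Longrightarrow> y \<in> set R \<Longrightarrow> y < x"
    and n: "\<And>x. x \<in> set L \<union> set R \<Longrightarrow> x < n"
  shows "contains L [1, 3, 2] \<or> contains R [1, 3, 2]"
proof -
  obtain x y z where xyz: "subseq [x, y, z] (L @ n # R)" "x < z" "z < y"
    using assms(1) contains_132_iff by blast
  then obtain as bs where ab: "[x, y, z] = as @ bs" "subseq as L" "subseq bs (n # R)"
    by (auto simp: subseq_append_iff)
  have R: "v < n" if "v \<in> set R" for v
    using n that by auto
  have as: "set as \<subseteq> set L" and bs: "set bs \<subseteq> set R \<union> {n}"
    using subseq_set_subset[OF ab(2)] subseq_set_subset[OF ab(3)] by auto
  consider "as = []" "bs = [x, y, z]" | "as = [x]" "bs = [y, z]" | "as = [x, y]" "bs = [z]"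
    | "as = [x, y, z]" "bs = []"
    using ab(1) unfolding Cons_eq_append_conv by fastforce
  thus ?thesis
  proof cases
    case 1
    moreover have "x \<noteq> n" using bs xyz n 1 by fastforce
    ultimately have "subseq [x, y, z] R" using ab(3) by simp
    thus ?thesis using xyz contains_132_iff by blast
  next
    case 2
    have "z \<in> set R" using 2 bs as xyz n by fastforce
    thus ?thesis using 2 LR[of x z] as xyz by auto
  next
    case 3
    thus ?thesis using LR[of x z] n[of y] n[of x] as bs xyz by auto
  next
    case 4
    thus ?thesis using ab(2) xyz contains_132_iff by blast
  qed
qed

text \<open>Supplies the two order hypotheses of the statements about words
  \<open>L @ n # R\<close>.\<close>

lemma glue_order:
  assumes "L \<in> perms_132 a" "R \<in> perms_132 b"
  shows "x \<in> set (map (\<lambda>x. x + length R) L) \<Longrightarrow> y \<in> set R \<Longrightarrow> y < x"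
    and "x \<in> set (map (\<lambda>x. x + length R) L) \<union> set R \<Longrightarrow> x < Suc (length L + length R)"
proof -
  have s: "set L = {1..a}" "set R = {1..b}" "length L = a" "length R = b"
    using assms length_perms_132 by (auto simp: perms_132_iff)
  show "x \<in> set (map (\<lambda>x. x + length R) L) \<Longrightarrow> y \<in> set R \<Longrightarrow> y < x"
    "x \<in> set (map (\<lambda>x. x + length R) L) \<union> set R \<Longrightarrow> x < Suc (length L + length R)"
    by (auto simp: s)
qed

lemma glue_in_perms_132:
  assumes "L \<in> perms_132 a" "R \<in> perms_132 b"
  shows "glue L R \<in> perms_132 (Suc (a + b))"
proof -
  have s: "set L = {1..a}" "set R = {1..b}" "length L = a" "length R = b"
    using assms length_perms_132 by (auto simp: perms_132_iff)
  have "(\<lambda>x. x + b) ` {1..a} = {b + 1..a + b}"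
    using image_add_atLeastAtMost[of b 1 a] by (simp add: add.commute)
  hence "set (glue L R) = {1..Suc (a + b)}"
    by (auto simp: glue_def s)
  moreover have "distinct (glue L R)"
  proof -
    have "distinct L" "distinct R" using assms by (auto simp: perms_132_iff)
    thus ?thesis by (auto simp: glue_def s distinct_map inj_on_def)
  qed
  moreover have "avoids (glue L R) [1, 3, 2]"
  proof
    assume "contains (glue L R) [1, 3, 2]"
    from this[unfolded glue_def] glue_order[OF assms]
    have "contains (map (\<lambda>x. x + length R) L) [1, 3, 2] \<or> contains R [1, 3, 2]"
      by (rule contains_132_gluedD)
    thus False using assms unfolding contains_map_add perms_132_iff by blast
  qed
  ultimately show ?thesis by (simp add: perms_132_iff)
qed

text \<open>Equal lengths give equal largest letters. This letter occurs exactly once, so its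
  position separates the two parts.\<close>

lemma glue_inject:
  assumes "L \<in> perms_132 a" "R \<in> perms_132 b" "L' \<in> perms_132 a'" "R' \<in> perms_132 b'"
    and eq: "glue L R = glue L' R'"
  shows "L = L' \<and> R = R'"
proof -
  let ?n = "Suc (length L + length R)"
  have "length (glue L R) = length (glue L' R')" using eq by simp
  hence n: "Suc (length L' + length R') = ?n" by (simp add: glue_def)
  have notin: "?n \<notin> set (map (\<lambda>x. x + length R) L) \<union> set R"
    "?n \<notin> set (map (\<lambda>x. x + length R') L') \<union> set R'"
    using glue_order(2)[OF assms(1,2), of ?n] glue_order(2)[OF assms(3,4), of ?n] n by auto
  have "map (\<lambda>x. x + length R) L @ ?n # R = map (\<lambda>x. x + length R') L' @ ?n # R'"
    using eq n by (simp add: glue_def)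
  hence "map (\<lambda>x. x + length R) L = map (\<lambda>x. x + length R') L' \<and> R = R'"
    by (subst (asm) append_Cons_eq_iff) (use notin in blast)+
  hence *: "map (\<lambda>x. x + length R) L = map (\<lambda>x. x + length R') L'" "R = R'"
    by blast+
  have "inj (\<lambda>x. x + length R)" by (simp add: inj_on_def)
  hence "L = L'" using * by (simp only: inj_map_eq_map)
  thus ?thesis using * by simp
qed

text \<open>A number below \<open>Max B\<close> cannot belong to \<open>A\<close>, so
  \<open>B\<close> is closed downwards in \<open>{1..n}\<close> and therefore an initial
  interval.\<close>

lemma lower_part_interval:
  fixes A B :: "nat set"
  assumes "A \<union> B = {1..n}" "\<And>x y. x \<in> A \<Longrightarrow> y \<in> B \<Longrightarrow> y < x"
  shows "B = {1..card B}" "A = {card B + 1..n}"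
proof -
  have fin: "finite B" using assms(1) by (metis finite_Un finite_atLeastAtMost)
  have B: "B = {1..Max B}" if "B \<noteq> {}"
  proof (intro equalityI subsetI)
    fix x assume "x \<in> B"
    thus "x \<in> {1..Max B}" using assms(1) fin by auto
  next
    fix x assume x: "x \<in> {1..Max B}"
    have m: "Max B \<in> B" using fin that by simp
    hence "Max B \<le> n" using assms(1) by auto
    hence "x \<in> A \<union> B" unfolding assms(1) using x by auto
    thus "x \<in> B" using assms(2)[of x "Max B"] m x by auto
  qed
  show *: "B = {1..card B}"
  proof (cases "B = {}")
    case False
    have "card B = Max B" using arg_cong[OF B[OF False], of card] by simp
    thus ?thesis using B[OF False] by simp
  qed simp
  have "A \<inter> B = {}" using assms(2) by blast
  hence "A = {1..n} - {1..card B}" using assms(1) * by blast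
  thus "A = {card B + 1..n}" by auto
qed

lemma perms_132_Suc_glue:
  assumes "\<rho> \<in> perms_132 (Suc n)"
  obtains a L R where "a \<le> n" "L \<in> perms_132 a" "R \<in> perms_132 (n - a)" "\<rho> = glue L R"
proof -
  have \<rho>: "distinct \<rho>" "set \<rho> = {1..Suc n}" "avoids \<rho> [1, 3, 2]"
    using assms by (auto simp: perms_132_iff)
  have "Suc n \<in> set \<rho>" using \<rho> by simp
  then obtain M R where MR: "\<rho> = M @ Suc n # R" by (meson split_list)
  have un: "set M \<union> set R = {1..n}"
  proof -
    have "set M \<union> set R = set \<rho> - {Suc n}" using MR \<rho>(1) by auto
    also have "\<dots> = {1..n}" unfolding \<rho>(2) by auto
    finally show ?thesis .
  qed
  \<comment> \<open>Otherwise \<open>x\<close>, \<open>Suc n\<close>, \<open>y\<close> would be a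
    132.\<close>
  have desc: "y < x" if "x \<in> set M" "y \<in> set R" for x y
  proof (rule ccontr)
    assume "\<not> y < x"
    moreover have "x \<noteq> y" using that MR \<rho>(1) by auto
    ultimately have "x < y" by simp
    moreover have "y \<in> {1..n}" using that un by blast
    hence "y < Suc n" by simp
    moreover have "subseq ([x] @ [Suc n, y]) (M @ Suc n # R)"
      using that by (intro list_emb_append_mono) (auto simp: subseq_singleton_left)
    ultimately have "contains \<rho> [1, 3, 2]"
      unfolding MR contains_132_iff append_Cons append_Nil by blast
    thus False using \<rho>(3) by blast
  qed
  have cR: "card (set R) = length R" using MR \<rho>(1) by (auto intro: distinct_card)
  have R: "set R = {1..length R}" and M: "set M = {length R + 1..n}"
    using lower_part_interval[OF un desc] cR by auto
  have "length R \<le> n"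
    using un cR card_mono[of "{1..n}" "set R"] by auto
  have lM: "length M = n - length R"
    using M MR \<rho>(1) distinct_card[of M] by simp
  \<comment> \<open>The truncated subtraction is exact, since every letter of \<open>M\<close>
    exceeds \<open>length R\<close>.\<close>
  define L where "L = map (\<lambda>x. x - length R) M"
  have M_eq: "M = map (\<lambda>x. x + length R) L"
    using M by (auto simp: L_def o_def intro!: map_idI[symmetric])
  have "set L = {1..n - length R}"
  proof -
    have "(\<lambda>x. x - length R) ` {length R + 1..n} = {1..n - length R}"
      by (auto simp: image_iff intro!: bexI[of _ "_ + length R"])
    thus ?thesis by (simp add: L_def M)
  qed
  moreover have "distinct L" using M_eq MR \<rho>(1) by (auto simp: distinct_map)
  moreover have "avoids M [1, 3, 2]" "avoids R [1, 3, 2]"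
    using \<rho>(3) MR contains_trans contains_subseq
    by (meson subseq_rev_drop_many subseq_drop_many subseq_order.order_refl list_emb_Cons)+
  hence "avoids L [1, 3, 2]" "avoids R [1, 3, 2]"
    using M_eq contains_map_add by auto
  ultimately have "L \<in> perms_132 (n - length R)" "R \<in> perms_132 (length R)"
    using R MR \<rho>(1) by (auto simp: perms_132_iff)
  moreover have "\<rho> = glue L R"
    using M_eq MR lM \<open>length R \<le> n\<close> by (simp add: glue_def L_def)
  ultimately show ?thesis
    using that[of "n - length R" L R] \<open>length R \<le> n\<close> by simp
qed


section \<open>Counting\<close>

text \<open>By \<open>mono\<close>, avoiding \<open>B q\<close> implies avoiding \<open>A q\<close>.
  The indicator of avoiding \<open>A q\<close> while containing \<open>B q\<close> is thus a
  difference of two avoidance indicators, and the product of these differences over \<open>Q\<close>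
  is expanded.\<close>

lemma inclusion_exclusion_avoid_contain:
  includes fps_syntax
  fixes A B :: "'i \<Rightarrow> nat list"
  assumes fin: "finite Q"
    and mono: "\<And>q \<rho>. q \<in> Q \<Longrightarrow> contains \<rho> (A q) \<Longrightarrow> contains \<rho> (B q)"
  shows "gf_avoid_contain (A ` Q) (B ` Q) =
    (\<Sum>I\<in>Pow Q. (-1) ^ card I * gf_avoid (A ` (Q - I) \<union> B ` I))"
proof (rule fps_ext)
  fix n
  let ?av = "\<lambda>\<rho> T. of_bool (\<forall>t\<in>T. avoids \<rho> t) :: int"
  \<comment> \<open>Indices with the same pattern do no harm when passing to the image set, because
    indicators are idempotent.\<close>
  have prod_av: "(\<Prod>q\<in>I. of_bool (avoids \<rho> (f q))) = ?av \<rho> (f ` I)"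
    if "I \<subseteq> Q" for I \<rho> and f :: "'i \<Rightarrow> nat list"
    using finite_subset[OF that fin] by induction auto
  have sign: "((-1) ^ c * f) $ n = (-1) ^ c * (f $ n)" for c and f :: "int fps"
    by (cases "even c") auto
  have "of_bool ((\<forall>t\<in>A ` Q. avoids \<rho> t) \<and> (\<forall>t\<in>B ` Q. contains \<rho> t))
      = (\<Sum>I\<in>Pow Q. (-1) ^ card I * ?av \<rho> (A ` (Q - I) \<union> B ` I))" for \<rho>
  proof -
    have "of_bool ((\<forall>t\<in>A ` Q. avoids \<rho> t) \<and> (\<forall>t\<in>B ` Q. contains \<rho> t))
        = (\<Prod>q\<in>Q. of_bool (avoids \<rho> (A q) \<and> contains \<rho> (B q)) :: int)"
      using fin by induction auto
    also have "\<dots> = (\<Prod>q\<in>Q. of_bool (avoids \<rho> (A q)) - of_bool (avoids \<rho> (B q)))"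
      by (rule prod.cong) (use mono in auto)
    also have "\<dots> = (\<Sum>I\<in>Pow Q. (-1) ^ card I * ?av \<rho> (A ` (Q - I) \<union> B ` I))"
      unfolding prod_diff_conv_sum[OF fin]
      by (rule sum.cong) (auto simp: prod_av)
    finally show ?thesis .
  qed
  hence "(\<Sum>\<rho>\<in>perms_132 n. of_bool ((\<forall>t\<in>A ` Q. avoids \<rho> t) \<and> (\<forall>t\<in>B ` Q. contains \<rho> t)))
      = (\<Sum>I\<in>Pow Q. (-1) ^ card I * (\<Sum>\<rho>\<in>perms_132 n. ?av \<rho> (A ` (Q - I) \<union> B ` I)))"
    unfolding sum_distrib_left by (subst sum.swap) simp
  moreover have "(\<Sum>\<rho>\<in>perms_132 n. of_bool (P \<rho>)) = int (card {\<rho> \<in> perms_132 n. P \<rho>})" for P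
    using finite_perms_132 by (simp add: sum_of_bool_eq Int_def)
  ultimately show "gf_avoid_contain (A ` Q) (B ` Q) $ n =
      (\<Sum>I\<in>Pow Q. (-1) ^ card I * gf_avoid (A ` (Q - I) \<union> B ` I)) $ n"
    by (simp add: gf_avoid_contain_def gf_avoid_def fps_sum_nth sign)
qed

text \<open>A subset of size \<open>k\<close> encodes a choice i_1 < ... < i_k of indices.\<close>

lemma sum_Pow_by_card:
  fixes f :: "'a set \<Rightarrow> 'b :: comm_monoid_add"
  assumes "finite Q"
  shows "(\<Sum>I\<in>Pow Q. f I) = (\<Sum>k=0..card Q. \<Sum>I | I \<subseteq> Q \<and> card I = k. f I)"
proof -
  have "(\<Sum>k=0..card Q. \<Sum>I | I \<in> Pow Q \<and> card I = k. f I) = (\<Sum>I\<in>Pow Q. f I)"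
    by (rule sum.group) (use assms card_mono in auto)
  thus ?thesis by simp
qed

section \<open>The recurrence, by counting glued pairs\<close>

text \<open>For each length \<open>n + 1\<close>, \<open>glue\<close> is a bijection from the
  disjoint union of the products \<open>AC j a \<times> AV j (n - a)\<close> onto the avoiders.
  Summing over \<open>a\<close> is a Cauchy product, and \<open>fps_X\<close> accounts for the
  largest letter.\<close>

lemma gf_avoid_recurrence:
  includes fps_syntax
  fixes \<tau> :: "'i \<Rightarrow> nat list"
  assumes fin: "finite Q"
    and \<tau>: "\<And>i. i \<in> Q \<Longrightarrow> distinct (\<tau> i) \<and> avoids (\<tau> i) [1, 3, 2] \<and> \<tau> i \<noteq> []"
  shows "gf_avoid (\<tau> ` Q) = 1 + fps_X * (\<Sum>j\<in>(\<Pi>\<^sub>E i\<in>Q. {0..last_index (\<tau> i)}).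
     gf_avoid_contain ((\<lambda>i. prefix_pat (\<tau> i) (int (j i))) ` Q)
                      ((\<lambda>i. prefix_pat (\<tau> i) (int (j i) - 1)) ` Q)
     * gf_avoid ((\<lambda>i. suffix_pat (\<tau> i) (j i)) ` Q))"
proof (rule fps_ext)
  fix m
  define J where "J = (\<Pi>\<^sub>E i\<in>Q. {0..last_index (\<tau> i)})"
  define AC where "AC j a = {L \<in> perms_132 a. \<forall>i\<in>Q. contains L (prefix_pat (\<tau> i) (int (j i) - 1))
      \<and> avoids L (prefix_pat (\<tau> i) (int (j i)))}" for j a
  define AV where "AV j b = {R \<in> perms_132 b. \<forall>i\<in>Q. avoids R (suffix_pat (\<tau> i) (j i))}" for j b
  have finJ: "finite J" unfolding J_def using fin by (intro finite_PiE) auto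
  have fins: "finite (AC j a)" "finite (AV j a)" for j a
    by (auto simp: AC_def AV_def finite_perms_132)
  have AC: "gf_avoid_contain ((\<lambda>i. prefix_pat (\<tau> i) (int (j i))) ` Q)
      ((\<lambda>i. prefix_pat (\<tau> i) (int (j i) - 1)) ` Q) $ a = int (card (AC j a))" for j a
    by (auto simp: gf_avoid_contain_def AC_def intro!: arg_cong[of _ _ card])
  have AV: "gf_avoid ((\<lambda>i. suffix_pat (\<tau> i) (j i)) ` Q) $ b = int (card (AV j b))" for j b
    by (auto simp: gf_avoid_def AV_def intro!: arg_cong[of _ _ card])
  have avoid: "(\<forall>i\<in>Q. avoids (glue L R) (\<tau> i)) \<longleftrightarrow> (\<exists>j\<in>J. L \<in> AC j a \<and> R \<in> AV j b)"
    if LR: "L \<in> perms_132 a" "R \<in> perms_132 b" for L R a b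
  proof -
    let ?C = "\<lambda>i j. contains L (prefix_pat (\<tau> i) (int j - 1)) \<and> avoids L (prefix_pat (\<tau> i) (int j)) \<and>
       avoids R (suffix_pat (\<tau> i) j)"
    have "avoids (glue L R) (\<tau> i) \<longleftrightarrow> (\<exists>j\<le>last_index (\<tau> i). ?C i j)" if "i \<in> Q" for i
    proof -
      have "distinct (\<tau> i)" "avoids (\<tau> i) [1, 3, 2]" "\<tau> i \<noteq> []"
        using \<tau>[OF that] by auto
      from this glue_order[OF LR] show ?thesis
        \<comment> \<open>The prefixes are tested on the shifted copy of \<open>L\<close> inside the
          glued word; shifting does not affect containment.\<close>
        unfolding glue_def contains_map_add[of "length R" L, symmetric]
        by (rule avoids_glued_iff)
    qed
    hence "(\<forall>i\<in>Q. avoids (glue L R) (\<tau> i)) \<longleftrightarrow> (\<forall>i\<in>Q. \<exists>j\<le>last_index (\<tau> i). ?C i j)"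
      by blast
    also have "\<dots> \<longleftrightarrow> (\<exists>j\<in>J. \<forall>i\<in>Q. ?C i (j i))"
    proof
      assume "\<forall>i\<in>Q. \<exists>j\<le>last_index (\<tau> i). ?C i j"
      then obtain j where "\<forall>i\<in>Q. j i \<le> last_index (\<tau> i) \<and> ?C i (j i)" by metis
      thus "\<exists>j\<in>J. \<forall>i\<in>Q. ?C i (j i)"
        \<comment> \<open>The chosen indices are restricted to \<open>Q\<close> because members of
          \<open>J\<close> must be \<open>undefined\<close> outside it.\<close>
        by (intro bexI[of _ "restrict j Q"]) (auto simp: J_def)
    qed (fastforce simp: J_def PiE_iff)
    also have "\<dots> \<longleftrightarrow> (\<exists>j\<in>J. L \<in> AC j a \<and> R \<in> AV j b)"
      using LR by (auto simp: AC_def AV_def)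
    finally show ?thesis .
  qed
  have unique: "j = j'" if "j \<in> J" "j' \<in> J" "L \<in> AC j a" "L \<in> AC j' a'" for j j' L a a'
  proof (rule PiE_ext)
    show "j \<in> (\<Pi>\<^sub>E i\<in>Q. {0..last_index (\<tau> i)})" "j' \<in> (\<Pi>\<^sub>E i\<in>Q. {0..last_index (\<tau> i)})"
      using that by (auto simp: J_def)
    show "j i = j' i" if "i \<in> Q" for i
      using prefix_index_unique[of "\<tau> i" "j i" "j' i" L] that \<tau>[OF that]
        \<open>j \<in> J\<close> \<open>j' \<in> J\<close> \<open>L \<in> AC j a\<close> \<open>L \<in> AC j' a'\<close>
      by (auto simp: J_def AC_def PiE_iff)
  qed
  show "gf_avoid (\<tau> ` Q) $ m = (1 + fps_X * (\<Sum>j\<in>J.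
     gf_avoid_contain ((\<lambda>i. prefix_pat (\<tau> i) (int (j i))) ` Q)
                      ((\<lambda>i. prefix_pat (\<tau> i) (int (j i) - 1)) ` Q)
     * gf_avoid ((\<lambda>i. suffix_pat (\<tau> i) (j i)) ` Q))) $ m" (is "_ = ?rhs $ m")
  proof (cases m)
    case 0
    \<comment> \<open>The constant term 1 counts the empty permutation, which avoids every nonempty
      pattern.\<close>
    have "avoids [] (\<tau> i)" if "i \<in> Q" for i
      using \<tau>[OF that] by (auto simp: contains_def order_iso_def)
    moreover have "avoids [] [1, 3, 2]"
      by (auto simp: contains_def order_iso_def)
    ultimately have "{\<rho> \<in> perms_132 0. \<forall>t\<in>\<tau> ` Q. avoids \<rho> t} = {[]}"
      by (auto simp: perms_132_iff)
    thus ?thesis using 0 by (simp add: gf_avoid_def)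
  next
    case (Suc n)
    define X where "X = (\<lambda>(j, a). AC j a \<times> AV j (n - a))"
    let ?U = "\<Union>x\<in>J \<times> {0..n}. X x"
    have "{\<rho> \<in> perms_132 (Suc n). \<forall>t\<in>\<tau> ` Q. avoids \<rho> t} = (\<lambda>(L, R). glue L R) ` ?U"
    proof (intro equalityI subsetI)
      fix \<rho> assume "\<rho> \<in> {\<rho> \<in> perms_132 (Suc n). \<forall>t\<in>\<tau> ` Q. avoids \<rho> t}"
      hence \<rho>: "\<rho> \<in> perms_132 (Suc n)" "\<forall>i\<in>Q. avoids \<rho> (\<tau> i)" by auto
      obtain a L R where LR: "a \<le> n" "L \<in> perms_132 a" "R \<in> perms_132 (n - a)" "\<rho> = glue L R"
        using \<rho>(1) by (rule perms_132_Suc_glue)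
      obtain j where "j \<in> J" "L \<in> AC j a" "R \<in> AV j (n - a)"
        using avoid[OF LR(2,3)] \<rho>(2) LR(4) by blast
      hence "(L, R) \<in> X (j, a)" "(j, a) \<in> J \<times> {0..n}"
        using LR(1) by (auto simp: X_def)
      thus "\<rho> \<in> (\<lambda>(L, R). glue L R) ` ?U"
        using LR(4) by (intro image_eqI[of _ _ "(L, R)"] UN_I[of "(j, a)"]) simp_all
    next
      fix \<rho> assume "\<rho> \<in> (\<lambda>(L, R). glue L R) ` ?U"
      then obtain j a L R where jaLR: "j \<in> J" "a \<le> n" "L \<in> AC j a" "R \<in> AV j (n - a)" "\<rho> = glue L R"
        by (auto simp: X_def)
      hence LR: "L \<in> perms_132 a" "R \<in> perms_132 (n - a)"
        by (auto simp: AC_def AV_def)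
      show "\<rho> \<in> {\<rho> \<in> perms_132 (Suc n). \<forall>t\<in>\<tau> ` Q. avoids \<rho> t}"
        using avoid[OF LR] glue_in_perms_132[OF LR] jaLR by auto
    qed
    moreover have "inj_on (\<lambda>(L, R). glue L R) ?U"
    proof (rule inj_onI)
      fix x y assume xy: "x \<in> ?U" "y \<in> ?U" "(case x of (L, R) \<Rightarrow> glue L R) = (case y of (L, R) \<Rightarrow> glue L R)"
      then obtain L R L' R' a a' b b' where "x = (L, R)" "y = (L', R')"
        "L \<in> perms_132 a" "R \<in> perms_132 b" "L' \<in> perms_132 a'" "R' \<in> perms_132 b'"
        by (auto simp: X_def AC_def AV_def)
      thus "x = y" using glue_inject xy(3) by auto
    qed
    ultimately have "card {\<rho> \<in> perms_132 (Suc n). \<forall>t\<in>\<tau> ` Q. avoids \<rho> t} = card ?U"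
      by (simp add: card_image)
    also have "\<dots> = (\<Sum>x\<in>J \<times> {0..n}. card (X x))"
    proof (rule card_UN_disjoint)
      show "\<forall>x\<in>J \<times> {0..n}. \<forall>y\<in>J \<times> {0..n}. x \<noteq> y \<longrightarrow> X x \<inter> X y = {}"
      proof (intro ballI impI)
        fix x y assume xy: "x \<in> J \<times> {0..n}" "y \<in> J \<times> {0..n}" "x \<noteq> y"
        obtain j a j' a' where e: "x = (j, a)" "y = (j', a')" by (cases x, cases y)
        have False if L: "L \<in> AC j a" "L \<in> AC j' a'" for L
        proof -
          \<comment> \<open>The length of \<open>L\<close> recovers \<open>a\<close>, and the
            prefixes that it contains recover \<open>j\<close>.\<close>
          have "a = a'" using L length_perms_132[of L a] length_perms_132[of L a'] by (auto simp: AC_def)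
          moreover have "j = j'" using unique[of j j' L a a'] L xy e by auto
          ultimately show False using xy e by simp
        qed
        thus "X x \<inter> X y = {}" by (auto simp: X_def e)
      qed
    qed (use finJ fins in \<open>auto simp: X_def\<close>)
    also have "\<dots> = (\<Sum>j\<in>J. \<Sum>a=0..n. card (AC j a) * card (AV j (n - a)))"
      unfolding sum.cartesian_product
      by (intro sum.cong) (auto simp: X_def card_cartesian_product)
    finally have "gf_avoid (\<tau> ` Q) $ m =
        (\<Sum>j\<in>J. \<Sum>a=0..n. int (card (AC j a)) * int (card (AV j (n - a))))"
      by (simp add: Suc gf_avoid_def)
    also have "\<dots> = ?rhs $ m"
      \<comment> \<open>Read from right to left, the convolution sums are coefficients of products
        at \<open>n\<close>, and the factor \<open>fps_X\<close> moves them to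
        \<open>Suc n\<close>.\<close>
      unfolding AC[symmetric] AV[symmetric] fps_mult_nth[symmetric] fps_sum_nth[symmetric]
      by (simp add: Suc)
    finally show ?thesis .
  qed
qed

theorem theorem2:
  fixes p :: nat and \<tau> :: "nat \<Rightarrow> nat list" and d :: "nat \<Rightarrow> nat"
  assumes "p \<ge> 1"
    and "\<And>i. i \<in> {1..p} \<Longrightarrow> \<tau> i \<in> perms_132 (d i)"
    and "\<And>i. i \<in> {1..p} \<Longrightarrow> \<tau> i \<noteq> []"
    and "\<And>i i'. i \<in> {1..p} \<Longrightarrow> i' \<in> {1..p} \<Longrightarrow> i \<noteq> i' \<Longrightarrow> avoids (\<tau> i) (\<tau> i')"
  shows
    "gf_avoid (\<tau> ` {1..p}) =
       1 + fps_X * (\<Sum>j\<in>(\<Pi>\<^sub>E i\<in>{1..p}. {0..last_index (\<tau> i)}).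
         gf_avoid_contain ((\<lambda>i. prefix_pat (\<tau> i) (int (j i))) ` {1..p})
                          ((\<lambda>i. prefix_pat (\<tau> i) (int (j i) - 1)) ` {1..p})
         * gf_avoid ((\<lambda>i. suffix_pat (\<tau> i) (j i)) ` {1..p}))
     \<and> (\<forall>j\<in>(\<Pi>\<^sub>E i\<in>{1..p}. {0..last_index (\<tau> i)}).
         gf_avoid_contain ((\<lambda>i. prefix_pat (\<tau> i) (int (j i))) ` {1..p})
                          ((\<lambda>i. prefix_pat (\<tau> i) (int (j i) - 1)) ` {1..p})
         = (\<Sum>k=0..p. (-1) ^ k * (\<Sum>I | I \<subseteq> {1..p} \<and> card I = k.
              gf_avoid ((\<lambda>q. prefix_pat (\<tau> q) (int (j q))) ` ({1..p} - I)
                        \<union> (\<lambda>q. prefix_pat (\<tau> q) (int (j q) - 1)) ` I))))"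
proof (intro conjI ballI)
  have \<tau>: "distinct (\<tau> i) \<and> avoids (\<tau> i) [1, 3, 2] \<and> \<tau> i \<noteq> []" if "i \<in> {1..p}" for i
    using assms(2,3)[OF that] by (simp add: perms_132_iff)
  show "gf_avoid (\<tau> ` {1..p}) =
       1 + fps_X * (\<Sum>j\<in>(\<Pi>\<^sub>E i\<in>{1..p}. {0..last_index (\<tau> i)}).
         gf_avoid_contain ((\<lambda>i. prefix_pat (\<tau> i) (int (j i))) ` {1..p})
                          ((\<lambda>i. prefix_pat (\<tau> i) (int (j i) - 1)) ` {1..p})
         * gf_avoid ((\<lambda>i. suffix_pat (\<tau> i) (j i)) ` {1..p}))"
    by (rule gf_avoid_recurrence) (use \<tau> in auto)
  fix j assume j: "j \<in> (\<Pi>\<^sub>E i\<in>{1..p}. {0..last_index (\<tau> i)})"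
  let ?A = "\<lambda>q. prefix_pat (\<tau> q) (int (j q))" and ?B = "\<lambda>q. prefix_pat (\<tau> q) (int (j q) - 1)"
  have "gf_avoid_contain (?A ` {1..p}) (?B ` {1..p}) =
      (\<Sum>I\<in>Pow {1..p}. (-1) ^ card I * gf_avoid (?A ` ({1..p} - I) \<union> ?B ` I))"
  proof (rule inclusion_exclusion_avoid_contain)
    fix q \<rho> assume q: "q \<in> {1..p}" "contains \<rho> (?A q)"
    have "j q \<le> last_index (\<tau> q)" using j q(1) by (auto simp: PiE_iff)
    thus "contains \<rho> (?B q)"
      \<comment> \<open>Monotonicity is stated for indices lowered by one, so the prefix of index
        \<open>j q\<close> enters as \<open>Suc (j q)\<close>.\<close>
      using contains_prefix_pat_mono[of "\<tau> q" "j q" "Suc (j q)" \<rho>] \<tau>[OF q(1)] q(2)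
      unfolding prefix_pat_Suc by simp
  qed simp
  also have "\<dots> = (\<Sum>k=0..p. \<Sum>I | I \<subseteq> {1..p} \<and> card I = k.
      (-1) ^ k * gf_avoid (?A ` ({1..p} - I) \<union> ?B ` I))"
    by (simp add: sum_Pow_by_card)
  finally show "gf_avoid_contain (?A ` {1..p}) (?B ` {1..p}) =
      (\<Sum>k=0..p. (-1) ^ k * (\<Sum>I | I \<subseteq> {1..p} \<and> card I = k.
         gf_avoid (?A ` ({1..p} - I) \<union> ?B ` I)))"
    by (simp add: sum_distrib_left)
qed

end
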